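(* Let $\alpha<\beta$ be positive irrationals with $1/\alpha+1/\beta=1$. Suppose that for some integer-valued constraint function $f$ depending only on $x_0$, the modified 2-pile subtraction game with constraint function $f$ has $\{([n\alpha],[n\beta])\mid n\in\mathbb{Z}_{\ge0}\}$ as its set of $P$-positions. Then one of the following is true: (i) $\alpha=\dfrac{2-t+\sqrt{t^2+4}}{2}$ for some integer $t>0$; (ii) $[\beta]=3$ or $[\beta]=4$, and there exist integers $p,q>0$ such that $$\alpha=\frac{\sqrt{4pq+([\beta]p-1)^2}+2q-([\beta]p-1)}{2q};$$ (iii) $[\beta]=4$ and there exist integers $p,q>0$ such that $$\alpha=\frac{\sqrt{4pq+(q-3p-1)^2}+3q-3p-1}{2q};$$ (iv) $[\beta]\geq 5$ or, equivalently, $\alpha<5/4$.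
   Context: $[\cdot]$ denotes the floor function. Modified 2-pile subtraction game with integer-valued constraint function $f$ depending only on $x_0$: a position consists of two piles of tokens and is written $(x,y)$ with $0\le x\le y<\infty$ (the smaller pile is always listed first). Two players alternate; on each turn the player does one of the following. (aa) Remove any positive number of tokens from a single pile, possibly the entire pile. (bb) Remove a positive number of tokens from each pile, moving from $(x_0,y_0)$ to $(x_1,y_1)$ (so $0\le x_1<x_0$, $0\le y_1<y_0$), where $|(y_0-y_1)-(x_0-x_1)|<f(x_0)$. The player who leaves both piles empty wins (normal play). A position is an $N$-position if the player moving from it has a winning strategy, and a $P$-position otherwise. *)

theory Defs
  imports Complex_Main
begin

type_synonym pos = "nat \<times> nat"

definition is_pos :: "pos \<Rightarrow> bool" where
  "is_pos p \<longleftrightarrow> fst p \<le> snd p"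

text \<open>
  In \<open>take_both\<close> the target \<open>(x1, y1)\<close> is read with its smaller pile first, also when the
  removal exchanges the order of the two piles. Bounding instead the difference of the numbers of
  tokens physically taken from the two piles allows the same moves: if the order is exchanged,
  that difference is \<open>(y0 - x0) + (y1 - x1)\<close>, which is at least
  \<open>\<bar>(y0 - x0) - (y1 - x1)\<bar>\<close>, so the option is already given by the rule below.
\<close>

inductive move :: "(nat \<Rightarrow> int) \<Rightarrow> pos \<Rightarrow> pos \<Rightarrow> bool" for f :: "nat \<Rightarrow> int" where
  take_smaller: "x0 \<le> y0 \<Longrightarrow> 0 < k \<Longrightarrow> k \<le> x0 \<Longrightarrow> move f (x0, y0) (x0 - k, y0)"
| take_larger: "x0 \<le> y0 \<Longrightarrow> 0 < k \<Longrightarrow> k \<le> y0 \<Longrightarrow>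
    move f (x0, y0) (min x0 (y0 - k), max x0 (y0 - k))"
| take_both: "x0 \<le> y0 \<Longrightarrow> x1 \<le> y1 \<Longrightarrow> x1 < x0 \<Longrightarrow> y1 < y0 \<Longrightarrow>
    \<bar>(int y0 - int y1) - (int x0 - int x1)\<bar> < f x0 \<Longrightarrow> move f (x0, y0) (x1, y1)"

definition complete_play :: "(nat \<Rightarrow> int) \<Rightarrow> pos \<Rightarrow> pos list \<Rightarrow> bool" where
  "complete_play f p ps \<longleftrightarrow>
     ps \<noteq> [] \<and> hd ps = p \<and> successively (move f) ps \<and> last ps = (0, 0)"

definition is_strategy :: "(nat \<Rightarrow> int) \<Rightarrow> (pos \<Rightarrow> pos) \<Rightarrow> bool" where
  "is_strategy f \<sigma> \<longleftrightarrow> (\<forall>p. is_pos p \<and> p \<noteq> (0, 0) \<longrightarrow> move f p (\<sigma> p))"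

text \<open>The player who starts moves at the even indices of a play.\<close>

definition first_player_follows :: "(pos \<Rightarrow> pos) \<Rightarrow> pos list \<Rightarrow> bool" where
  "first_player_follows \<sigma> ps \<longleftrightarrow> (\<forall>i. even i \<and> Suc i < length ps \<longrightarrow> ps ! Suc i = \<sigma> (ps ! i))"

text \<open>
  The total number of tokens decreases with every move and only \<open>(0, 0)\<close> has no move, so
  every play can be continued to a complete one. The starting player makes the last move of a
  complete play iff the number of moves, \<open>length ps - 1\<close>, is odd.
\<close>

definition winning_strategy :: "(nat \<Rightarrow> int) \<Rightarrow> pos \<Rightarrow> (pos \<Rightarrow> pos) \<Rightarrow> bool" where
  "winning_strategy f p \<sigma> \<longleftrightarrow> is_strategy f \<sigma> \<and>
     (\<forall>ps. complete_play f p ps \<and> first_player_follows \<sigma> ps \<longrightarrow> odd (length ps - 1))"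

definition N_position :: "(nat \<Rightarrow> int) \<Rightarrow> pos \<Rightarrow> bool" where
  "N_position f p \<longleftrightarrow> is_pos p \<and> (\<exists>\<sigma>. winning_strategy f p \<sigma>)"

definition P_position :: "(nat \<Rightarrow> int) \<Rightarrow> pos \<Rightarrow> bool" where
  "P_position f p \<longleftrightarrow> is_pos p \<and> \<not> N_position f p"

end

theory Submission
  imports Defs "HOL-Analysis.Kronecker_Approximation_Theorem"
begin

text \<open>
  Put \<open>a n = \<lfloor>n \<alpha>\<rfloor>\<close>, \<open>b n = \<lfloor>n \<beta>\<rfloor>\<close>, \<open>d n = b n - a n\<close>, and let \<open>\<gamma>\<close> and \<open>\<delta>\<close> be the fractional
  parts of \<open>\<alpha>\<close> and \<open>\<beta>\<close>, so that \<open>\<gamma> (\<lfloor>\<beta>\<rfloor> - 1 + \<delta>) = 1\<close>.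

  The game enters through a single inequality. No move joins two \<open>P\<close>-positions, which gives
  \<open>f (a n) \<le> d n - d (n - 1)\<close>. Conversely a position \<open>(a n, a l)\<close> with \<open>a n \<le> a l < b n\<close> must have a
  move to a \<open>P\<close>-position. Taking from one pile does not achieve this, because the positive values
  of \<open>a\<close> and \<open>b\<close> are disjoint; so tokens are taken from both piles, and some \<open>d k\<close> has distance
  less than \<open>d n - d (n - 1)\<close> from \<open>a l - a n\<close> (\<open>differences_approximate\<close>).

  The step \<open>d n - d (n - 1)\<close> is read off from the point \<open>(x n, y n)\<close> of fractional parts of \<open>n \<alpha>\<close> and
  \<open>n \<beta>\<close>: it is smallest, namely \<open>\<lfloor>\<beta>\<rfloor> - 2\<close>, on the rectangle \<open>x < \<gamma>, y > \<delta>\<close> (a drop), and largest,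
  namely \<open>\<lfloor>\<beta>\<rfloor>\<close>, on the rectangle \<open>x > \<gamma>, y < \<delta>\<close> (a jump). For \<open>\<lfloor>\<beta>\<rfloor> \<le> 3\<close> a drop contradicts the
  inequality at once (\<open>drop_impossible\<close>). For \<open>\<lfloor>\<beta>\<rfloor> = 4\<close> a jump leaves a hole of length 4
  among the differences, and a later drop that sees the middle of this hole is a contradiction
  (\<open>drop_and_jump_impossible\<close>).

  It remains to see which orbits \<open>(x n, y n)\<close> on the torus stay away from these rectangles. By
  Kronecker's theorem the closure of the orbit contains a line of negative slope through the origin,
  or it is a family of parallel lines \<open>q x - p y = k\<close> of positive slope, \<open>k\<close> ranging over the
  integers (\<open>orbit_closure_cases\<close>). Both rectangles have a corner at the orbit point \<open>(\<gamma>, \<delta>)\<close> and lie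
  on opposite sides of it in a direction of negative slope, so lines of the first kind meet both.
  In the second case the drop rectangle is missed only if \<open>q \<gamma> + p (1 - \<delta>) \<le> 1\<close>; the left side is a
  positive integer, hence it is 1. This is a quadratic equation for \<open>\<alpha>\<close> and yields the second
  formula. Missing the jump rectangle yields \<open>q (1 - \<gamma>) + p \<delta> = 1\<close> in the same way, which is the third
  formula; and when \<open>\<lfloor>\<beta>\<rfloor> = 4\<close> and both rectangles are met, a jump and a drop with the forbidden
  relative position can be found among the orbit points (\<open>drop_or_jump_relation\<close>). For \<open>\<lfloor>\<beta>\<rfloor> = 2\<close> the
  equation forces \<open>q = 1\<close>, and \<open>p > 1\<close> is excluded by comparing a jump with a step of size one
  (\<open>level_and_jump_impossible\<close>), which leaves the golden ratio.
\<close>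

section \<open>Backward induction on the game\<close>

lemma move_decreases: "move f p q \<Longrightarrow> fst q + snd q < fst p + snd p"
  by (induction rule: move.induct) (auto simp: min_def max_def)

lemma move_is_pos: "move f p q \<Longrightarrow> is_pos q"
  by (induction rule: move.induct) (auto simp: is_pos_def)

text \<open>
  The usual recursive description of the winner. The game itself is defined by strategies for a
  fixed starting player, and the two notions are compared in \<open>P_position_iff_not_wins\<close>.
\<close>

function wins :: "(nat \<Rightarrow> int) \<Rightarrow> pos \<Rightarrow> bool" where
  "wins f p \<longleftrightarrow> (\<exists>q \<in> {q. move f p q}. \<not> wins f q)"
  by pat_completeness auto
termination
  by (relation "Wellfounded.measure (\<lambda>(f, p). fst p + snd p)") (auto dest: move_decreases)

declare wins.simps [simp del]

lemma winsI: "move f p q \<Longrightarrow> \<not> wins f q \<Longrightarrow> wins f p"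
  using wins.simps [of f p] by blast

lemma winsE:
  assumes "wins f p"
  obtains q where "move f p q" "\<not> wins f q"
  using assms wins.simps [of f p] by blast

lemma not_wins_zero: "\<not> wins f (0, 0)"
proof
  assume "wins f (0, 0)"
  then obtain q where "move f (0, 0) q" by (rule winsE)
  from move_decreases [OF this] show False by simp
qed

text \<open>
  Against any strategy \<open>\<sigma>\<close> the second player can keep answering with a lost position; the play
  obtained in this way ends when the starting player has no move.
\<close>

lemma not_wins_play:
  assumes "is_strategy f \<sigma>" "is_pos p" "\<not> wins f p"
  shows "\<exists>ps. complete_play f p ps \<and> first_player_follows \<sigma> ps \<and> even (length ps - 1)"
  using assms(2,3)
proof (induction "fst p + snd p" arbitrary: p rule: less_induct)
  case less
  show ?case
  proof (cases "p = (0, 0)")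
    case True
    then show ?thesis
      by (intro exI [of _ "[p]"]) (simp add: complete_play_def first_player_follows_def)
  next
    case False
    define q where "q = \<sigma> p"
    have pq: "move f p q"
      using assms(1) less.prems False unfolding is_strategy_def q_def by blast
    with less.prems have "wins f q" using winsI by blast
    then obtain r where qr: "move f q r" and r: "\<not> wins f r" by (rule winsE)
    have "fst r + snd r < fst p + snd p"
      using move_decreases [OF pq] move_decreases [OF qr] by simp
    then obtain ps where ps: "complete_play f r ps" "first_player_follows \<sigma> ps" "even (length ps - 1)"
      using less.hyps [of r] r move_is_pos [OF qr] by blast
    have ne: "ps \<noteq> []" "hd ps = r" using ps(1) by (auto simp: complete_play_def)
    have "complete_play f p (p # q # ps)"
      using ps(1) pq qr by (cases ps) (auto simp: complete_play_def)
    moreover have "first_player_follows \<sigma> (p # q # ps)"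
      unfolding first_player_follows_def
    proof (intro allI impI)
      fix i assume i: "even i \<and> Suc i < length (p # q # ps)"
      show "(p # q # ps) ! Suc i = \<sigma> ((p # q # ps) ! i)"
      proof (cases i)
        case 0
        then show ?thesis by (simp add: q_def)
      next
        case (Suc j)
        with i obtain k where k: "j = Suc k" by (cases j) auto
        with i Suc have "even k \<and> Suc k < length ps" by auto
        with ps(2) show ?thesis by (simp add: first_player_follows_def Suc k)
      qed
    qed
    moreover have "even (length (p # q # ps) - 1)"
      using ps(3) ne by (cases ps) auto
    ultimately show ?thesis by blast
  qed
qed

text \<open>
  A strategy has to name a legal move at every nonzero position, also at the lost ones, where any
  move serves.
\<close>

lemma wins_strategy:
  obtains \<sigma> where "is_strategy f \<sigma>" "\<And>p. wins f p \<Longrightarrow> move f p (\<sigma> p) \<and> \<not> wins f (\<sigma> p)"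
proof -
  have move_ex: "\<exists>q. move f p q" if "is_pos p" "p \<noteq> (0, 0)" for p
  proof -
    obtain x y where p: "p = (x, y)" by (cases p)
    with that have "x \<le> y" "0 < y" by (auto simp: is_pos_def)
    then show ?thesis using move.take_larger [of x y y f] p by auto
  qed
  define \<sigma> where "\<sigma> p = (if wins f p then SOME q. move f p q \<and> \<not> wins f q else SOME q. move f p q)" for p
  have w: "move f p (\<sigma> p) \<and> \<not> wins f (\<sigma> p)" if "wins f p" for p
  proof -
    from that have "\<exists>q. move f p q \<and> \<not> wins f q" by (meson winsE)
    from someI_ex [OF this] that show ?thesis by (simp add: \<sigma>_def)
  qed
  have "is_strategy f \<sigma>"
    unfolding is_strategy_def
  proof (intro allI impI)
    fix p assume p: "is_pos p \<and> p \<noteq> (0, 0)"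
    show "move f p (\<sigma> p)"
    proof (cases "wins f p")
      case True
      then show ?thesis using w by blast
    next
      case False
      then show ?thesis using someI_ex [OF move_ex [of p]] p by (simp add: \<sigma>_def)
    qed
  qed
  with w that show thesis by blast
qed

lemma wins_play_odd:
  assumes \<sigma>: "\<And>p. wins f p \<Longrightarrow> move f p (\<sigma> p) \<and> \<not> wins f (\<sigma> p)"
    and "wins f p" "complete_play f p ps" "first_player_follows \<sigma> ps"
  shows "odd (length ps - 1)"
  using assms(2-4)
proof (induction "length ps" arbitrary: p ps rule: less_induct)
  case less
  from less.prems(2) obtain qs where ps: "ps = p # qs"
    by (cases ps) (auto simp: complete_play_def)
  have "qs \<noteq> []"
    using less.prems(1,2) not_wins_zero [of f] by (auto simp: complete_play_def ps)
  then obtain q rs where qs: "qs = q # rs" by (cases qs) auto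
  have "q = \<sigma> p"
    using less.prems(3) by (auto simp: first_player_follows_def ps qs dest: spec [of _ 0])
  with \<sigma> less.prems(1) have nq: "\<not> wins f q" by blast
  show ?case
  proof (cases rs)
    case Nil
    then show ?thesis by (simp add: ps qs)
  next
    case (Cons r ts)
    have qr: "move f q r" and cp: "complete_play f r rs"
      using less.prems(2) by (auto simp: complete_play_def ps qs Cons)
    have "wins f r" using qr nq winsI by blast
    moreover have "first_player_follows \<sigma> rs"
      unfolding first_player_follows_def
    proof (intro allI impI)
      fix i assume "even i \<and> Suc i < length rs"
      then have "even (Suc (Suc i)) \<and> Suc (Suc (Suc i)) < length ps" by (simp add: ps qs)
      with less.prems(3) have "ps ! Suc (Suc (Suc i)) = \<sigma> (ps ! Suc (Suc i))"
        unfolding first_player_follows_def by blast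
      then show "rs ! Suc i = \<sigma> (rs ! i)" by (simp add: ps qs)
    qed
    ultimately have "odd (length rs - 1)"
      using less.hyps [of rs r] cp by (simp add: ps qs)
    then show ?thesis by (simp add: ps qs Cons)
  qed
qed

lemma P_position_iff_not_wins: "P_position f p \<longleftrightarrow> is_pos p \<and> \<not> wins f p"
proof -
  have "(\<exists>\<sigma>. winning_strategy f p \<sigma>) \<longleftrightarrow> wins f p" if "is_pos p"
  proof
    assume "\<exists>\<sigma>. winning_strategy f p \<sigma>"
    then show "wins f p"
      using not_wins_play [of f _ p] that by (fastforce simp: winning_strategy_def)
  next
    assume "wins f p"
    then show "\<exists>\<sigma>. winning_strategy f p \<sigma>"
      using wins_strategy [of f] wins_play_odd [of f] unfolding winning_strategy_def by metis
  qed
  then show ?thesis by (auto simp: P_position_def N_position_def)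
qed

lemma P_position_move: "P_position f p \<Longrightarrow> move f p q \<Longrightarrow> \<not> P_position f q"
  using winsI P_position_iff_not_wins by blast

lemma non_P_position_move:
  assumes "is_pos p" "\<not> P_position f p"
  obtains q where "move f p q" "P_position f q"
  using assms move_is_pos by (metis P_position_iff_not_wins winsE)

section \<open>Closures of orbits on the torus\<close>

text \<open>
  The point \<open>(x, y)\<close> lies, modulo integers, in the closure of the two-sided orbit
  \<open>k (\<theta>, \<phi>)\<close>, \<open>k \<in> \<int>\<close>. Integer multipliers make the existence proofs free of sign conditions; large
  positive ones are recovered in \<open>orbit_limit_late\<close>.
\<close>

definition orbit_limit :: "real \<Rightarrow> real \<Rightarrow> real \<Rightarrow> real \<Rightarrow> bool" where
  "orbit_limit \<theta> \<phi> x y \<longleftrightarrow> (\<forall>\<epsilon>>0. \<exists>k h g :: int.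
     \<bar>of_int k * \<theta> - of_int h - x\<bar> < \<epsilon> \<and> \<bar>of_int k * \<phi> - of_int g - y\<bar> < \<epsilon>)"

text \<open>
  Dirichlet's theorem gives a positive \<open>r\<close> that moves the orbit by very little, and adding a large
  multiple of \<open>r\<close> to a good multiplier makes it large without spoiling the approximation.
\<close>

lemma orbit_limit_late:
  assumes "orbit_limit \<theta> \<phi> x y" "\<epsilon> > 0"
  obtains n :: nat and h g :: int where "n > N"
    "\<bar>real n * \<theta> - of_int h - x\<bar> < \<epsilon>" "\<bar>real n * \<phi> - of_int g - y\<bar> < \<epsilon>"
proof -
  obtain k h g :: int where k: "\<bar>of_int k * \<theta> - of_int h - x\<bar> < \<epsilon> / 2"
      "\<bar>of_int k * \<phi> - of_int g - y\<bar> < \<epsilon> / 2"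
    using assms unfolding orbit_limit_def by (meson half_gt_zero)
  \<comment> \<open>Enough copies of any \<open>r > 0\<close> to carry \<open>k\<close> beyond \<open>N\<close>; the error they cause is at most \<open>m / K\<close>.\<close>
  define m where "m = \<bar>k\<bar> + int N + 1"
  have m: "m > 0" by (simp add: m_def)
  obtain K :: nat where K: "K > 0" "1 / real K < \<epsilon> / (2 * of_int m)"
  proof -
    have "\<epsilon> / (2 * of_int m) > 0" using assms(2) m by simp
    then show thesis using that real_arch_inverse
      by (metis gr_zeroI inverse_eq_divide)
  qed
  obtain r :: int and s :: "nat \<Rightarrow> int" where r: "0 < r" "\<And>i. i < 2 \<Longrightarrow>
      \<bar>of_int r * (if i = 0 then \<theta> else \<phi>) - of_int (s i)\<bar> < 1 / real K"
    by (rule Dirichlet_approx_simult [OF K(1), of 2 "\<lambda>i. if i = (0::nat) then \<theta> else \<phi>"]) (rule that)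
  have step: "\<bar>of_int (k + m * r) * \<psi> - of_int (j + m * t) - z\<bar> < \<epsilon>"
    if "\<bar>of_int k * \<psi> - of_int j - z\<bar> < \<epsilon> / 2" "\<bar>of_int r * \<psi> - of_int t\<bar> < 1 / real K"
    for \<psi> z :: real and j t :: int
  proof -
    have "\<bar>of_int m * (of_int r * \<psi> - of_int t)\<bar> = of_int m * \<bar>of_int r * \<psi> - of_int t\<bar>"
      using m by (simp add: abs_mult)
    also have "\<dots> < of_int m * (\<epsilon> / (2 * of_int m))"
      using m that(2) K(2) by (intro mult_strict_left_mono) auto
    also have "\<dots> = \<epsilon> / 2" using m by simp
    finally have "\<bar>of_int m * (of_int r * \<psi> - of_int t)\<bar> < \<epsilon> / 2" .
    moreover have "of_int (k + m * r) * \<psi> - of_int (j + m * t) - z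
        = (of_int k * \<psi> - of_int j - z) + of_int m * (of_int r * \<psi> - of_int t)"
      by (simp add: algebra_simps)
    ultimately show ?thesis using that(1) by linarith
  qed
  have "m * 1 \<le> m * r" using r(1) m by (intro mult_left_mono) auto
  then have pos: "k + m * r > int N" using m_def by linarith
  show thesis
  proof (rule that [of "nat (k + m * r)" "h + m * s 0" "g + m * s 1"])
    show "N < nat (k + m * r)" using pos by simp
    have eq: "real (nat (k + m * r)) = of_int (k + m * r)" using pos by simp
    show "\<bar>real (nat (k + m * r)) * \<theta> - of_int (h + m * s 0) - x\<bar> < \<epsilon>"
      unfolding eq using step [OF k(1)] r(2) [of 0] by simp
    show "\<bar>real (nat (k + m * r)) * \<phi> - of_int (g + m * s 1) - y\<bar> < \<epsilon>"
      unfolding eq using step [OF k(2)] r(2) [of 1] by simp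
  qed
qed

lemma orbit_limit_box:
  assumes "orbit_limit \<theta> \<phi> x y"
    and "0 \<le> x0" "x0 < x" "x < x1" "x1 \<le> 1"
    and "0 \<le> y0" "y0 < y" "y < y1" "y1 \<le> 1"
  obtains n :: nat where "n > N" "x0 < frac (real n * \<theta>)" "frac (real n * \<theta>) < x1"
    "y0 < frac (real n * \<phi>)" "frac (real n * \<phi>) < y1"
proof -
  define \<epsilon> where "\<epsilon> = Min {x - x0, x1 - x, y - y0, y1 - y}"
  have "\<epsilon> > 0" using assms by (simp add: \<epsilon>_def)
  have le: "\<epsilon> \<le> x - x0" "\<epsilon> \<le> x1 - x" "\<epsilon> \<le> y - y0" "\<epsilon> \<le> y1 - y" by (simp_all add: \<epsilon>_def)
  obtain n :: nat and h g :: int where n: "n > N"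
    "\<bar>real n * \<theta> - of_int h - x\<bar> < \<epsilon>" "\<bar>real n * \<phi> - of_int g - y\<bar> < \<epsilon>"
    using orbit_limit_late [OF assms(1) \<open>\<epsilon> > 0\<close>] by metis
  have "frac (real n * \<theta>) = real n * \<theta> - of_int h" "frac (real n * \<phi>) = real n * \<phi> - of_int g"
    using n le assms by (auto simp: frac_unique_iff)
  with n le that show thesis by auto
qed

text \<open>
  A primitive relation \<open>a \<theta> + b \<phi> = c\<close> lets the second coordinate be controlled exactly: if the integers
  \<open>n, h, g\<close> satisfy \<open>n c - a h - b g = k\<close>, then the errors of the two approximations satisfy
  \<open>a e\<^sub>1 + b e\<^sub>2 = 0\<close>, so only \<open>e\<^sub>1\<close> has to be made small. One solution exists by Bezout, and it may be
  shifted by \<open>n \<mapsto> n + b n'\<close>, \<open>h \<mapsto> h + b h'\<close>; the one-dimensional Kronecker theorem chooses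
  \<open>n'\<close> and \<open>h'\<close>.
\<close>

lemma orbit_limit_of_relation:
  fixes a b c :: int
  assumes "\<theta> \<notin> \<rat>" and rel: "of_int a * \<theta> + of_int b * \<phi> = of_int c"
    and "b \<noteq> 0" and gcd1: "gcd (gcd a b) c = 1"
    and xy: "of_int a * x + of_int b * y = of_int k"
  shows "orbit_limit \<theta> \<phi> x y"
  unfolding orbit_limit_def
proof (intro allI impI)
  fix \<epsilon> :: real assume "\<epsilon> > 0"
  obtain u v where uv: "u * a + v * b = gcd a b" using bezout_int by blast
  obtain w z where wz: "w * gcd a b + z * c = 1" using bezout_int gcd1 by metis
  define n0 h0 g0 where "n0 = k * z" and "h0 = - (k * w * u)" and "g0 = - (k * w * v)"
  have "n0 * c - a * h0 - b * g0 = k * (w * (u * a + v * b) + z * c)"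
    unfolding n0_def h0_def g0_def by (simp add: algebra_simps)
  then have base: "n0 * c - a * h0 - b * g0 = k" by (simp add: uv wz)
  define \<eta> where "\<eta> = \<epsilon> / (1 + \<bar>of_int a\<bar> + \<bar>of_int b\<bar>)"
  have \<eta>: "\<eta> > 0" using \<open>\<epsilon> > 0\<close> by (simp add: \<eta>_def add_pos_nonneg)
  have \<eta>\<epsilon>: "\<eta> * (1 + \<bar>of_int a\<bar> + \<bar>of_int b\<bar>) = \<epsilon>" unfolding \<eta>_def by (simp add: add_nonneg_eq_0_iff)
  have b1: "\<bar>of_int b :: real\<bar> \<ge> 1" using \<open>b \<noteq> 0\<close> by linarith
  obtain h' n' where hn: "\<bar>of_int n' * \<theta> - of_int h' - (x - of_int n0 * \<theta> + of_int h0) / of_int b\<bar>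
      < \<eta> / \<bar>of_int b\<bar>"
    using sequence_of_fractional_parts_is_dense [OF assms(1), of "\<eta> / \<bar>of_int b\<bar>"] \<eta> b1
    by (metis divide_pos_pos zero_less_abs_iff \<open>b \<noteq> 0\<close> of_int_eq_0_iff)
  define n h g where "n = n0 + b * n'" and "h = h0 + b * h'" and "g = g0 + n' * c - a * h'"
  have exact: "n * c - a * h - b * g = k"
    using base unfolding n_def h_def g_def by (simp add: algebra_simps)
  have "of_int n * \<theta> - of_int h - x
      = of_int b * (of_int n' * \<theta> - of_int h' - (x - of_int n0 * \<theta> + of_int h0) / of_int b)"
    using \<open>b \<noteq> 0\<close> by (simp add: n_def h_def field_simps)
  then have "\<bar>of_int n * \<theta> - of_int h - x\<bar>
      = \<bar>of_int b\<bar> * \<bar>of_int n' * \<theta> - of_int h' - (x - of_int n0 * \<theta> + of_int h0) / of_int b\<bar>"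
    by (simp add: abs_mult)
  also have "\<dots> < \<bar>of_int b\<bar> * (\<eta> / \<bar>of_int b\<bar>)"
    using hn b1 by (intro mult_strict_left_mono) auto
  also have "\<dots> = \<eta>" using \<open>b \<noteq> 0\<close> by simp
  finally have 1: "\<bar>of_int n * \<theta> - of_int h - x\<bar> < \<eta>" .
  have "of_int n * (of_int c :: real) - of_int a * of_int h - of_int b * of_int g = of_int k"
    using exact by (metis of_int_diff of_int_mult)
  then have "of_int n * (of_int a * \<theta> + of_int b * \<phi>) - of_int a * of_int h - of_int b * of_int g
      = of_int a * x + of_int b * y"
    using rel xy by simp
  then have "of_int b * (of_int n * \<phi> - of_int g - y) = - (of_int a * (of_int n * \<theta> - of_int h - x))"
    by (simp add: algebra_simps)
  then have "\<bar>of_int b\<bar> * \<bar>of_int n * \<phi> - of_int g - y\<bar> = \<bar>of_int a\<bar> * \<bar>of_int n * \<theta> - of_int h - x\<bar>"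
    by (metis abs_minus_cancel abs_mult)
  moreover have "1 * \<bar>of_int n * \<phi> - of_int g - y\<bar> \<le> \<bar>of_int b\<bar> * \<bar>of_int n * \<phi> - of_int g - y\<bar>"
    by (intro mult_right_mono b1) auto
  moreover have "\<bar>of_int a\<bar> * \<bar>of_int n * \<theta> - of_int h - x\<bar> \<le> \<bar>of_int a\<bar> * \<eta>"
    using 1 by (intro mult_left_mono) auto
  ultimately have 2: "\<bar>of_int n * \<phi> - of_int g - y\<bar> \<le> \<bar>of_int a\<bar> * \<eta>" by linarith
  have "\<epsilon> = \<eta> + \<eta> * \<bar>of_int a\<bar> + \<eta> * \<bar>of_int b\<bar>" unfolding \<eta>\<epsilon> [symmetric] by (simp add: algebra_simps)
  moreover have "\<eta> * \<bar>of_int b\<bar> > 0" "\<eta> * \<bar>of_int a\<bar> \<ge> 0" using \<eta> b1 by auto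
  ultimately show "\<exists>k h g :: int. \<bar>of_int k * \<theta> - of_int h - x\<bar> < \<epsilon> \<and> \<bar>of_int k * \<phi> - of_int g - y\<bar> < \<epsilon>"
    using 1 2 by (intro exI [of _ n] exI [of _ h] exI [of _ g]) (auto simp: mult.commute)
qed

lemma orbit_limit_of_independence:
  assumes indep: "\<And>a b c :: int. of_int a * \<theta> + of_int b * \<phi> + of_int c = 0 \<Longrightarrow> a = 0 \<and> b = 0"
  shows "orbit_limit \<theta> \<phi> x y"
  unfolding orbit_limit_def
proof (intro allI impI)
  fix \<epsilon> :: real assume "\<epsilon> > 0"
  have ne: "\<theta> \<noteq> 1" "\<phi> \<noteq> 1" "\<theta> \<noteq> \<phi>"
    using indep [of 1 0 "-1"] indep [of 0 1 "-1"] indep [of 1 "-1" 0] by auto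
  define \<psi> where "\<psi> i = (if i = 0 then \<theta> else if i = 1 then \<phi> else 1)" for i :: nat
  interpret Modules.module "(\<lambda>r. (*) (real_of_int r))"
    by (simp add: Modules.module.intro distrib_left mult.commute)
  have im: "\<psi> ` {..2} = {\<theta>, \<phi>, 1}"
    by (auto simp: \<psi>_def image_iff numeral_2_eq_2 atMost_Suc)
  have "independent (\<psi> ` {..2})"
    unfolding im
  proof
    assume "dependent {\<theta>, \<phi>, 1}"
    then obtain u where u: "\<exists>v \<in> {\<theta>, \<phi>, 1}. u v \<noteq> 0" "(\<Sum>v \<in> {\<theta>, \<phi>, 1}. of_int (u v) * v) = 0"
      by (subst (asm) dependent_finite) auto
    from u(2) have sum: "of_int (u \<theta>) * \<theta> + of_int (u \<phi>) * \<phi> + of_int (u 1) = 0"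
      using ne by (simp add: add.assoc)
    with indep have 0: "u \<theta> = 0" "u \<phi> = 0" by blast+
    with sum have "u 1 = 0" by simp
    with 0 u(1) show False by auto
  qed
  moreover have "inj_on \<psi> {..2}"
  proof (rule eq_card_imp_inj_on)
    show "card (\<psi> ` {..2}) = card {..2::nat}" unfolding im using ne by simp
  qed simp
  moreover have "\<psi> 2 = 1" by (simp add: \<psi>_def)
  ultimately obtain k m where
    km: "\<And>i. i < 2 \<Longrightarrow> \<bar>of_int k * \<psi> i - of_int (m i) - (if i = 0 then x else y)\<bar> < \<epsilon>"
    using Kronecker_thm_2 [of \<psi> 2 \<epsilon> "\<lambda>i. if i = 0 then x else y"] \<open>\<epsilon> > 0\<close> by blast
  show "\<exists>k h g :: int. \<bar>of_int k * \<theta> - of_int h - x\<bar> < \<epsilon> \<and> \<bar>of_int k * \<phi> - of_int g - y\<bar> < \<epsilon>"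
    using km [of 0] km [of 1] by (intro exI [of _ k] exI [of _ "m 0"] exI [of _ "m 1"]) (simp add: \<psi>_def)
qed

text \<open>
  Lines are followed through the point \<open>(\<theta>, \<phi>)\<close>, which belongs to the orbit. A dense orbit is put into
  the first case: only one line of negative slope is ever needed. In the second case \<open>p, q, c\<close> have no
  common divisor, so every integer \<open>k\<close> gives a line in the closure.
\<close>

lemma orbit_closure_cases:
  assumes "\<theta> \<notin> \<rat>" "\<phi> \<notin> \<rat>"
  obtains
    (falling) a b :: real where "a > 0" "b > 0" "\<And>\<tau>. orbit_limit \<theta> \<phi> (\<theta> - b * \<tau>) (\<phi> + a * \<tau>)"
  | (rising) p q c :: int where "p > 0" "q > 0" "of_int q * \<theta> - of_int p * \<phi> = of_int c"
      "\<And>x y k. of_int q * x - of_int p * y = of_int k \<Longrightarrow> orbit_limit \<theta> \<phi> x y"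
proof (cases "\<forall>a b c :: int. of_int a * \<theta> + of_int b * \<phi> + of_int c = 0 \<longrightarrow> a = 0 \<and> b = 0")
  case True
  then have "orbit_limit \<theta> \<phi> x y" for x y using orbit_limit_of_independence by blast
  then show thesis using falling [of 1 1] by simp
next
  case False
  then obtain a0 b0 c0 :: int where rel0: "of_int a0 * \<theta> + of_int b0 * \<phi> + of_int c0 = 0"
    and n0: "a0 \<noteq> 0 \<or> b0 \<noteq> 0" by blast
  define g where "g = gcd (gcd a0 b0) c0"
  have g: "g \<noteq> 0" using n0 by (auto simp: g_def)
  \<comment> \<open>The relation is made primitive, since only then every line \<open>a x + b y = k\<close> is reached.\<close>
  define a b c where "a = a0 div g" and "b = b0 div g" and "c = - (c0 div g)"
  have "g dvd a0" "g dvd b0" "g dvd c0"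
    by (auto simp: g_def intro: dvd_trans)
  then have abc: "a0 = g * a" "b0 = g * b" "c0 = g * (- c)"
    by (auto simp: a_def b_def c_def)
  have g0: "\<bar>g\<bar> = g" by (simp add: g_def)
  have "g = gcd (gcd (g * a) (g * b)) (g * (- c))"
    unfolding abc [symmetric] by (rule g_def)
  also have "\<dots> = g * gcd (gcd a b) (- c)"
    using gcd_mult_distrib_int [of g a b] gcd_mult_distrib_int [of g "gcd a b" "- c"] g0 by simp
  finally have gcd1: "gcd (gcd a b) c = 1" using g by simp
  have "of_int g * (of_int a * \<theta> + of_int b * \<phi> - of_int c) = 0"
    using rel0 unfolding abc by (simp add: algebra_simps)
  with g have rel: "of_int a * \<theta> + of_int b * \<phi> = of_int c" by simp
  have ab: "a \<noteq> 0 \<or> b \<noteq> 0" using n0 abc by auto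
  have an: "a \<noteq> 0"
  proof
    assume "a = 0"
    with ab rel have "\<phi> = of_int c / of_int b" by (simp add: field_simps)
    with assms(2) show False by simp
  qed
  have bn: "b \<noteq> 0"
  proof
    assume "b = 0"
    with ab rel have "\<theta> = of_int c / of_int a" by (simp add: field_simps)
    with assms(1) show False by simp
  qed
  have lim: "orbit_limit \<theta> \<phi> x y" if "of_int a * x + of_int b * y = of_int k" for x y k
    using orbit_limit_of_relation [OF assms(1) rel bn gcd1 that] .
  have same: thesis if "sgn a = sgn b"
  proof (rule falling [of "\<bar>of_int a\<bar>" "\<bar>of_int b\<bar>"])
    fix \<tau> :: real
    have "of_int a * \<bar>of_int b :: real\<bar> = of_int b * \<bar>of_int a\<bar>"
      using that an bn by (auto simp: sgn_if abs_if split: if_splits)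
    then have "of_int a * (\<theta> - \<bar>of_int b\<bar> * \<tau>) + of_int b * (\<phi> + \<bar>of_int a\<bar> * \<tau>) = of_int c"
      using rel by (simp add: algebra_simps)
    then show "orbit_limit \<theta> \<phi> (\<theta> - \<bar>of_int b\<bar> * \<tau>) (\<phi> + \<bar>of_int a\<bar> * \<tau>)" by (rule lim)
  qed (use an bn in auto)
  show thesis
  proof (cases "sgn a = sgn b")
    case True
    then show ?thesis by (rule same)
  next
    case False
    with an bn consider "a > 0" "b < 0" | "a < 0" "b > 0" by (auto simp: sgn_if split: if_splits)
    then show ?thesis
    proof cases
      case 1
      show ?thesis
        by (rule rising [of "- b" a c]) (use 1 rel in \<open>auto intro: lim\<close>)
    next
      case 2
      show ?thesis
      proof (rule rising [of b "- a" "- c"])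
        fix x y :: real and k :: int
        assume "of_int (- a) * x - of_int b * y = of_int k"
        then have "of_int a * x + of_int b * y = of_int (- k)" by simp
        then show "orbit_limit \<theta> \<phi> x y" by (rule lim)
      qed (use 2 rel in auto)
    qed
  qed
qed

section \<open>Complementary Beatty sequences\<close>

locale complementary_beatty =
  fixes \<alpha> \<beta> :: real
  assumes alpha_pos: "0 < \<alpha>" and alpha_less_beta: "\<alpha> < \<beta>"
    and alpha_irrational: "\<alpha> \<notin> \<rat>" and beta_irrational: "\<beta> \<notin> \<rat>"
    and complementary: "1 / \<alpha> + 1 / \<beta> = 1"
begin

text \<open>
  The points \<open>(x n, y n)\<close> are defined from \<open>\<gamma>\<close> and \<open>\<delta>\<close>, the fractional parts of \<open>\<alpha>\<close> and \<open>\<beta>\<close>; they are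
  also the fractional parts of \<open>n \<alpha>\<close> and \<open>n \<beta>\<close> (\<open>a_plus_x\<close>, \<open>b_plus_y\<close>).
\<close>

definition a :: "nat \<Rightarrow> int" where "a n = \<lfloor>real n * \<alpha>\<rfloor>"
definition b :: "nat \<Rightarrow> int" where "b n = \<lfloor>real n * \<beta>\<rfloor>"
definition d :: "nat \<Rightarrow> int" where "d n = b n - a n"
definition B :: int where "B = \<lfloor>\<beta>\<rfloor>"
definition \<gamma> :: real where "\<gamma> = \<alpha> - 1"
definition \<delta> :: real where "\<delta> = \<beta> - of_int B"
definition x :: "nat \<Rightarrow> real" where "x n = frac (real n * \<gamma>)"
definition y :: "nat \<Rightarrow> real" where "y n = frac (real n * \<delta>)"

lemma product_form: "(\<alpha> - 1) * (\<beta> - 1) = 1"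
proof -
  have "\<beta> > 0" using alpha_pos alpha_less_beta by simp
  then have "\<alpha> + \<beta> = \<alpha> * \<beta>" using complementary alpha_pos by (simp add: field_simps)
  then show ?thesis by (simp add: algebra_simps)
qed

lemma alpha_bounds: "1 < \<alpha>" "\<alpha> < 2" and beta_gt_2: "2 < \<beta>"
proof -
  have bp: "\<beta> > 0" using alpha_pos alpha_less_beta by simp
  then have "1 / \<beta> > 0" by simp
  then have "1 / \<alpha> < 1" using complementary by linarith
  then show 1: "1 < \<alpha>" using alpha_pos by (simp add: field_simps)
  have lt: "1 / \<beta> < 1 / \<alpha>" using alpha_pos alpha_less_beta by (simp add: field_simps)
  then have "1 / \<alpha> > 1 / 2" "1 / \<beta> < 1 / 2" using complementary by linarith+
  then show "\<alpha> < 2" "2 < \<beta>" using alpha_pos bp by (simp_all add: field_simps)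
qed

lemma gamma_bounds: "0 < \<gamma>" "\<gamma> < 1"
  using alpha_bounds by (simp_all add: \<gamma>_def)

lemma B_ge_2: "B \<ge> 2"
  using beta_gt_2 by (simp add: B_def le_floor_iff)

lemma delta_bounds: "0 < \<delta>" "\<delta> < 1"
proof -
  have "\<delta> = frac \<beta>" by (simp add: \<delta>_def B_def frac_def)
  moreover have "frac \<beta> \<noteq> 0" using beta_irrational by (auto simp: frac_eq_0_iff Ints_def)
  ultimately show "0 < \<delta>" "\<delta> < 1" using frac_ge_0 [of \<beta>] frac_lt_1 [of \<beta>] by auto
qed

lemma gamma_delta: "\<gamma> * (of_int B - 1 + \<delta>) = 1"
  using product_form by (simp add: \<gamma>_def \<delta>_def)

lemma gamma_irrational: "\<gamma> \<notin> \<rat>"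
proof
  assume "\<gamma> \<in> \<rat>"
  then have "\<gamma> + 1 \<in> \<rat>" by (intro Rats_add) auto
  with alpha_irrational show False by (simp add: \<gamma>_def)
qed

lemma delta_irrational: "\<delta> \<notin> \<rat>"
proof
  assume "\<delta> \<in> \<rat>"
  then have "\<delta> + of_int B \<in> \<rat>" by (intro Rats_add) auto
  with beta_irrational show False by (simp add: \<delta>_def)
qed

lemma a_plus_x: "real n * \<alpha> = of_int (a n) + x n"
proof -
  have "real n * \<alpha> = of_int (int n) + real n * \<gamma>" by (simp add: \<gamma>_def algebra_simps)
  then show ?thesis by (simp add: a_def x_def frac_def)
qed

lemma b_plus_y: "real n * \<beta> = of_int (b n) + y n"
proof -
  have "real n * \<beta> = of_int (int n * B) + real n * \<delta>" by (simp add: \<delta>_def algebra_simps)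
  moreover from this have "b n = int n * B + \<lfloor>real n * \<delta>\<rfloor>"
    unfolding b_def by (metis floor_add_int add.commute)
  ultimately show ?thesis by (simp add: y_def frac_def)
qed

lemma x_bounds: "0 \<le> x n" "x n < 1" and y_bounds: "0 \<le> y n" "y n < 1"
  by (simp_all add: x_def y_def frac_lt_1)

text \<open>
  Adding \<open>\<alpha>\<close> causes a carry exactly when the new fractional part is below \<open>\<gamma>\<close>, and similarly for
  \<open>\<beta>\<close> and \<open>\<delta>\<close>.
\<close>

lemma a_Suc: "a (Suc n) = a n + 1 + (if x (Suc n) < \<gamma> then 1 else 0)"
proof -
  have "real n * \<alpha> = of_int (a (Suc n)) + x (Suc n) - 1 - \<gamma>"
    using a_plus_x [of "Suc n"] by (simp add: \<gamma>_def algebra_simps)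
  then have e: "of_int (a n) + x n = of_int (a (Suc n)) + x (Suc n) - 1 - \<gamma>"
    using a_plus_x [of n] by simp
  show ?thesis
    using e gamma_bounds x_bounds [of n] x_bounds [of "Suc n"] by (auto split: if_splits)
qed

lemma b_Suc: "b (Suc n) = b n + B + (if y (Suc n) < \<delta> then 1 else 0)"
proof -
  have "real n * \<beta> = of_int (b (Suc n)) + y (Suc n) - of_int B - \<delta>"
    using b_plus_y [of "Suc n"] by (simp add: \<delta>_def algebra_simps)
  then have e: "of_int (b n) + y n = of_int (b (Suc n)) + y (Suc n) - of_int B - \<delta>"
    using b_plus_y [of n] by simp
  show ?thesis
    using e delta_bounds y_bounds [of n] y_bounds [of "Suc n"] by (auto split: if_splits)
qed

lemma a_0 [simp]: "a 0 = 0" and b_0 [simp]: "b 0 = 0" and d_0 [simp]: "d 0 = 0"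
  by (simp_all add: a_def b_def d_def)

lemma d_Suc:
  "d (Suc n) = d n + B - 1 + (if y (Suc n) < \<delta> then 1 else 0) - (if x (Suc n) < \<gamma> then 1 else 0)"
  by (simp add: d_def a_Suc b_Suc)

lemma d_mono: "m \<le> n \<Longrightarrow> d m \<le> d n"
  by (rule lift_Suc_mono_le [of d]) (use B_ge_2 in \<open>auto simp: d_Suc\<close>)

lemma a_strict_mono: "m < n \<Longrightarrow> a m < a n"
  by (rule lift_Suc_mono_less [of a]) (auto simp: a_Suc)

lemma b_strict_mono: "m < n \<Longrightarrow> b m < b n"
  by (rule lift_Suc_mono_less [of b]) (use B_ge_2 in \<open>auto simp: b_Suc\<close>)

lemma a_inject: "a m = a n \<longleftrightarrow> m = n"
  using a_strict_mono by (metis less_irrefl linorder_neqE_nat)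

lemma d_nonneg: "0 \<le> d n"
  using d_mono [of 0 n] by simp

lemma a_nonneg: "0 \<le> a n"
  using alpha_pos by (simp add: a_def)

lemma a_pos: "n > 0 \<Longrightarrow> 0 < a n"
  using a_strict_mono [of 0 n] by simp

lemma a_le_b: "a n \<le> b n"
  using d_nonneg [of n] by (simp add: d_def)

lemma b_ge: "2 * int n \<le> b n"
  by (induction n) (use B_ge_2 in \<open>auto simp: b_Suc\<close>)

text \<open>
  The disjointness half of Beatty's theorem: if \<open>m \<alpha>\<close> and \<open>n \<beta>\<close> have the same integer part \<open>N\<close>, then
  dividing by \<open>\<alpha>\<close> and \<open>\<beta>\<close> and adding puts \<open>m + n\<close> strictly between \<open>N\<close> and \<open>N + 1\<close>.
\<close>

lemma a_eq_b_imp_0: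
  assumes "a m = b n"
  shows "m = 0"
proof (rule ccontr)
  assume "m \<noteq> 0"
  have bp: "\<beta> > 0" using beta_gt_2 by simp
  define N where "N = a m"
  have N: "real m * \<alpha> = of_int N + x m" "real n * \<beta> = of_int N + y n"
    using a_plus_x [of m] b_plus_y [of n] assms by (simp_all add: N_def)
  have xm: "x m \<noteq> 0"
  proof
    assume "x m = 0"
    with N(1) \<open>m \<noteq> 0\<close> have "\<alpha> = of_int N / of_nat m" by (simp add: field_simps)
    with alpha_irrational show False by simp
  qed
  have "real m + real n = (of_int N + x m) * (1 / \<alpha>) + (of_int N + y n) * (1 / \<beta>)"
    unfolding N [symmetric] using alpha_pos bp by simp
  also have "\<dots> = of_int N * (1 / \<alpha> + 1 / \<beta>) + (x m * (1 / \<alpha>) + y n * (1 / \<beta>))"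
    by (simp add: algebra_simps)
  finally have sum: "real m + real n = of_int N + (x m * (1 / \<alpha>) + y n * (1 / \<beta>))"
    using complementary by simp
  have "x m * (1 / \<alpha>) > 0" using xm x_bounds [of m] alpha_pos by simp
  moreover have "y n * (1 / \<beta>) \<ge> 0" using y_bounds [of n] bp by simp
  moreover have "x m * (1 / \<alpha>) < 1 * (1 / \<alpha>)"
    using x_bounds [of m] alpha_pos by (intro mult_strict_right_mono) auto
  moreover have "y n * (1 / \<beta>) \<le> 1 * (1 / \<beta>)"
    using y_bounds [of n] bp by (intro mult_right_mono) auto
  ultimately have "of_int N < real m + real n" "real m + real n < of_int N + 1"
    using sum complementary by linarith+
  then have "N < int m + int n" "int m + int n < N + 1" by linarith+
  then show False by simp
qed

text \<open>
  This locates multiples of \<open>\<alpha>\<close> near \<open>a n + d M\<close>, and thereby decides which numbers at a prescribed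
  small distance from \<open>a n + d M\<close> are values of \<open>a\<close>. It rests on \<open>\<gamma> \<beta> = \<alpha>\<close>, by which \<open>\<gamma> b M\<close> is a multiple
  of \<open>\<alpha>\<close> up to the error \<open>\<gamma> y M\<close>.
\<close>

lemma shifted_index:
  "\<alpha> * of_int (int n + b M - 2 * int M)
     = of_int (a n + d M) + x n - x M - \<gamma> * y M"
proof -
  have ba: "\<gamma> * \<beta> = \<alpha>" using product_form by (simp add: \<gamma>_def algebra_simps)
  have "\<gamma> * of_int (b M) = \<gamma> * (real M * \<beta> - y M)" using b_plus_y [of M] by simp
  also have "\<dots> = real M * \<alpha> - \<gamma> * y M" using ba by (simp add: algebra_simps)
  finally have "\<alpha> * of_int (b M) = of_int (b M) + real M * \<alpha> - \<gamma> * y M"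
    by (simp add: \<gamma>_def algebra_simps)
  then show ?thesis
    using a_plus_x [of n] a_plus_x [of M] by (simp add: d_def algebra_simps)
qed

end

section \<open>What the game requires of the differences\<close>

locale game_beatty = complementary_beatty +
  fixes f :: "nat \<Rightarrow> int"
  assumes P_set: "{p. P_position f p} = {(nat \<lfloor>real n * \<alpha>\<rfloor>, nat \<lfloor>real n * \<beta>\<rfloor>) | n :: nat. True}"
begin

lemma P_position_iff: "P_position f p \<longleftrightarrow> (\<exists>n. p = (nat (a n), nat (b n)))"
  unfolding a_def b_def using P_set by blast

text \<open>
  Otherwise taking from both piles would lead from one \<open>P\<close>-position to its predecessor.
\<close>

lemma constraint_le_step: "f (nat (a (Suc n))) \<le> d (Suc n) - d n"
proof (rule ccontr)
  assume *: "\<not> f (nat (a (Suc n))) \<le> d (Suc n) - d n"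
  have "move f (nat (a (Suc n)), nat (b (Suc n))) (nat (a n), nat (b n))"
  proof (rule move.take_both)
    show "nat (a n) < nat (a (Suc n))" "nat (b n) < nat (b (Suc n))"
      using a_strict_mono [of n "Suc n"] b_strict_mono [of n "Suc n"] a_nonneg [of n] a_le_b [of n] by auto
    show "\<bar>int (nat (b (Suc n))) - int (nat (b n)) - (int (nat (a (Suc n))) - int (nat (a n)))\<bar>
        < f (nat (a (Suc n)))"
      using * d_mono [of n "Suc n"] a_nonneg [of n] a_nonneg [of "Suc n"] a_le_b [of n] a_le_b [of "Suc n"]
      by (simp add: d_def)
  qed (use a_le_b nat_mono in auto)
  then show False using P_position_move P_position_iff by blast
qed

text \<open>
  The position \<open>(a n, a l)\<close> is not a \<open>P\<close>-position, so it has a move to some \<open>(a k, b k)\<close>. A move in one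
  pile would keep \<open>a l\<close> or \<open>a n\<close> as a coordinate, but these are not values of \<open>b\<close>, and \<open>a n\<close> is only
  paired with \<open>b n\<close>, which is too large.
\<close>

lemma differences_approximate:
  assumes n: "n > 0" and l: "a n \<le> a l" "a l < b n"
  obtains k where "\<bar>d k - (a l - a n)\<bar> < d n - d (n - 1)"
proof -
  let ?p = "(nat (a n), nat (a l))"
  have l0: "l > 0" using l(1) a_pos [OF n] by (cases "l = 0") auto
  have an: "0 < a n" "0 < a l" using a_pos n l0 by auto
  have not_b: "a l \<noteq> b k" "a n \<noteq> b k" for k
    using a_eq_b_imp_0 l0 n by blast+
  have bk: "0 \<le> b k" "0 \<le> a k" for k using a_nonneg [of k] a_le_b [of k] by auto
  have "\<not> P_position f ?p"
    using not_b(1) an bk by (auto simp: P_position_iff eq_nat_nat_iff)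
  moreover have "is_pos ?p" using l(1) by (simp add: is_pos_def)
  ultimately obtain k where mv: "move f ?p (nat (a k), nat (b k))"
    using non_P_position_move P_position_iff by metis
  from mv show thesis
  proof (cases rule: move.cases)
    case (take_smaller i)
    then have "a l = b k" using an bk by (simp add: eq_nat_nat_iff)
    then show ?thesis using not_b by blast
  next
    case (take_larger i)
    show ?thesis
    proof (cases "nat (a l) - i < nat (a n)")
      case True
      then have "nat (b k) = nat (a n)" using take_larger by auto
      then have "a n = b k" using an bk by (simp add: eq_nat_nat_iff)
      then show ?thesis using not_b by blast
    next
      case False
      then have k: "nat (a k) = nat (a n)" "nat (b k) = nat (a l) - i" using take_larger by auto
      from k(1) have "k = n" using an bk by (simp add: eq_nat_nat_iff a_inject)
      moreover have "nat (b k) \<le> nat (a l)" unfolding k(2) by (rule diff_le_self)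
      ultimately have False using l(2) an by simp
      then show ?thesis ..
    qed
  next
    case take_both
    obtain m where m: "n = Suc m" using n by (cases n) auto
    have "\<bar>d k - (a l - a n)\<bar> < f (nat (a n))"
      using take_both an bk by (simp add: d_def abs_if split: if_splits)
    then show ?thesis
      using constraint_le_step [of m] that [of k] by (simp add: m)
  qed
qed

lemma floor_index:
  assumes "0 \<le> j" "of_int N \<le> \<alpha> * of_int j" "\<alpha> * of_int j < of_int N + 1"
  shows "a (nat j) = N"
  using assms by (simp add: a_def floor_unique mult.commute)

text \<open>
  For \<open>B = 2\<close> a drop is a step of size 0 and nothing can be approximated. For \<open>B = 3\<close> its size is 1, so
  differences have to be hit exactly; but \<open>a n + 1\<close> is a value of \<open>a\<close>, since two carries in succession
  are impossible when \<open>\<gamma> < 1/2\<close>, while \<open>d\<close> passes from 0 to 2.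
\<close>

lemma drop_impossible:
  assumes B: "B \<le> 3" and n: "n > 0" and drop: "x n < \<gamma>" "\<delta> \<le> y n"
  shows False
proof -
  obtain m where m: "n = Suc m" using n by (cases n) auto
  have step: "d n - d (n - 1) = B - 2" using drop by (simp add: m d_Suc)
  consider "B = 2" | "B = 3" using B B_ge_2 by linarith
  then show False
  proof cases
    case 1
    have "a n < b n" using a_le_b [of n] a_eq_b_imp_0 [of n n] n by force
    then show False
      using differences_approximate [OF n, of n] step 1 by force
  next
    case 2
    have "\<gamma> * 2 < \<gamma> * (of_int B - 1 + \<delta>)"
      using gamma_bounds delta_bounds 2 by (intro mult_strict_left_mono) auto
    then have g: "\<gamma> < 1 / 2" using gamma_delta by simp
    have "\<lfloor>real (Suc n) * \<alpha>\<rfloor> = a n + 1"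
      using a_plus_x [of n] drop g x_bounds [of n] gamma_bounds
      by (intro floor_unique) (auto simp: \<gamma>_def algebra_simps)
    then have an: "a (Suc n) = a n + 1" by (simp add: a_def)
    have x1: "x 1 = \<gamma>" "y 1 = \<delta>" 
      using gamma_bounds delta_bounds by (simp_all add: x_def y_def frac_eq)
    have d1: "d 1 = 2" using d_Suc [of 0] x1 2 by simp
    have "d n \<ge> 2" using d_mono [of 1 n] n d1 by simp
    then have "a (Suc n) < b n" by (simp add: an d_def)
    then obtain k where "\<bar>d k - 1\<bar> < 1"
      using differences_approximate [OF n, of "Suc n"] step 2 an by force
    then have "d k = 1" by simp
    then show False using d_mono [of 1 k] d1 by (cases "k = 0") auto
  qed
qed

text \<open>
  The jump at \<open>M\<close> leaves the open interval from \<open>d M - 4\<close> to \<open>d M\<close> free of differences, and the drop at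
  \<open>n\<close> only tolerates an error less than 2. Hence the midpoint \<open>d M - 2\<close> must not be seen from \<open>a n\<close>; the
  condition on \<open>x M + \<gamma> y M - x n\<close> says that it is, because \<open>a n + d M - 2\<close> is then a value of \<open>a\<close>.
\<close>

lemma drop_and_jump_impossible:
  assumes B: "B = 4" and M: "M > 0" and jump: "\<gamma> \<le> x M" "y M < \<delta>"
    and n: "n > M" and drop: "x n < \<gamma>" "\<delta> \<le> y n"
    and low: "x M + \<gamma> * y M - x n < 1 - \<gamma>"
  shows False
proof -
  obtain m where m: "M = Suc m" using M by (cases M) auto
  obtain n' where n': "n = Suc n'" using n by (cases n) auto
  have dM: "d M = d m + 4" using jump B by (simp add: m d_Suc)
  have step: "d n - d (n - 1) = 2" using drop B by (simp add: n' d_Suc)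
  define l where "l = nat (int n + b M - 2 * int M - 1)"
  have gy: "0 \<le> \<gamma> * y M" using gamma_bounds y_bounds [of M] by simp
  have al: "a l = a n + d M - 2"
    unfolding l_def
  proof (rule floor_index)
    show "0 \<le> int n + b M - 2 * int M - 1" using b_ge [of M] n by simp
    have e: "\<alpha> * of_int (int n + b M - 2 * int M - 1)
        = of_int (a n + d M) + x n - x M - \<gamma> * y M - 1 - \<gamma>"
      using shifted_index [of n M] by (simp add: \<gamma>_def algebra_simps)
    show "of_int (a n + d M - 2) \<le> \<alpha> * of_int (int n + b M - 2 * int M - 1)"
      unfolding e using low by simp
    show "\<alpha> * of_int (int n + b M - 2 * int M - 1) < of_int (a n + d M - 2) + 1"
      unfolding e using drop jump gy gamma_bounds by simp
  qed
  have "a n \<le> a l" using al dM d_nonneg [of m] by simp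
  moreover have "a l < b n" using al d_mono [of M n] n by (simp add: d_def)
  ultimately obtain k where k: "\<bar>d k - (d M - 2)\<bar> < 2"
    using differences_approximate [of n l] n step al by force
  show False
  proof (cases "k \<le> m")
    case True
    then show False using d_mono [of k m] k dM by simp
  next
    case False
    then show False using d_mono [of M k] k m by simp
  qed
qed

text \<open>
  For \<open>B = 2\<close> a jump skips the single number \<open>d M - 1\<close>, and a step of size 1 requires differences to be
  hit exactly.
\<close>

lemma level_and_jump_impossible:
  assumes B: "B = 2" and M: "M > 0" and jump: "\<gamma> \<le> x M" "y M < \<delta>"
    and n: "n > M" and level: "x n < \<gamma>" "y n < \<delta>"
    and low: "x M + \<gamma> * y M - x n < 1"
  shows False
proof -
  obtain m where m: "M = Suc m" using M by (cases M) auto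
  obtain n' where n': "n = Suc n'" using n by (cases n) auto
  have dM: "d M = d m + 2" using jump B by (simp add: m d_Suc)
  have step: "d n - d (n - 1) = 1" using level B by (simp add: n' d_Suc)
  define l where "l = nat (int n + b M - 2 * int M)"
  have gy: "0 \<le> \<gamma> * y M" using gamma_bounds y_bounds [of M] by simp
  have al: "a l = a n + d M - 1"
    unfolding l_def
  proof (rule floor_index)
    show "0 \<le> int n + b M - 2 * int M" using b_ge [of M] by simp
    show "of_int (a n + d M - 1) \<le> \<alpha> * of_int (int n + b M - 2 * int M)"
      unfolding shifted_index using low by simp
    show "\<alpha> * of_int (int n + b M - 2 * int M) < of_int (a n + d M - 1) + 1"
      unfolding shifted_index using level jump gy by simp
  qed
  have "a n \<le> a l" using al dM d_nonneg [of m] by simp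
  moreover have "a l < b n" using al d_mono [of M n] n by (simp add: d_def)
  ultimately obtain k where k: "\<bar>d k - (d M - 1)\<bar> < 1"
    using differences_approximate [of n l] n step al by force
  show False
  proof (cases "k \<le> m")
    case True
    then show False using d_mono [of k m] k dM by simp
  next
    case False
    then show False using d_mono [of M k] k m by simp
  qed
qed

end

section \<open>Quadratic relations forced by the missing steps\<close>

context complementary_beatty
begin

text \<open>
  Points near \<open>(\<gamma>, \<delta>)\<close> are described by their displacement: up to the left into the drop rectangle, down
  to the right into the jump rectangle.
\<close>

lemma drop_near:
  assumes "orbit_limit \<gamma> \<delta> (\<gamma> - s) (\<delta> + t)" "0 < s" "s < \<gamma>" "0 < t" "t < 1 - \<delta>" "\<eta> > 0"
  obtains n where "n > N" "\<gamma> - s - \<eta> < x n" "x n < \<gamma>" "\<delta> < y n"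
proof -
  obtain n where "n > N" "max 0 (\<gamma> - s - \<eta>) < frac (real n * \<gamma>)" "frac (real n * \<gamma>) < \<gamma>"
      "\<delta> < frac (real n * \<delta>)" "frac (real n * \<delta>) < 1"
    by (rule orbit_limit_box [OF assms(1), of "max 0 (\<gamma> - s - \<eta>)" \<gamma> \<delta> 1 N])
      (use assms gamma_bounds delta_bounds in auto)
  then show thesis using that [of n] by (simp add: x_def y_def)
qed

lemma jump_near:
  assumes "orbit_limit \<gamma> \<delta> (\<gamma> + s) (\<delta> - t)" "0 < s" "s < 1 - \<gamma>" "0 < t" "t < \<delta>" "\<eta> > 0"
  obtains n where "n > N" "\<gamma> < x n" "x n < \<gamma> + s + \<eta>" "y n < \<delta>" "y n < \<delta> - t + \<eta>"
proof -
  obtain n where "n > N" "\<gamma> < frac (real n * \<gamma>)" "frac (real n * \<gamma>) < min 1 (\<gamma> + s + \<eta>)"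
      "0 < frac (real n * \<delta>)" "frac (real n * \<delta>) < min \<delta> (\<delta> - t + \<eta>)"
    by (rule orbit_limit_box [OF assms(1), of \<gamma> "min 1 (\<gamma> + s + \<eta>)" 0 "min \<delta> (\<delta> - t + \<eta>)" N])
      (use assms gamma_bounds delta_bounds in auto)
  then show thesis using that [of n] by (simp add: x_def y_def)
qed

end

text \<open>
  The inequality \<open>1 < q X + p Y\<close> says that the corner \<open>(X, Y)\<close> lies beyond the line \<open>q s + p t = 1\<close>. The last
  bound selects a point close to the upper left end of the segment, where \<open>s\<close> is smallest.
\<close>

lemma line_meets_box:
  fixes p q X Y \<eta> :: real
  assumes "p > 0" "q > 0" "X > 0" "Y > 0" "1 < q * X + p * Y" "\<eta> > 0"
  obtains s t where "0 < s" "s < X" "0 < t" "t < Y" "q * s + p * t = 1"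
    "s < max 0 ((1 - p * Y) / q) + \<eta>"
proof -
  define L where "L = max 0 ((1 - p * Y) / q)"
  have "L < min (min X (1 / q)) (L + \<eta>)"
    using assms by (auto simp: L_def field_simps)
  then obtain s where s: "L < s" "s < X" "s < 1 / q" "s < L + \<eta>" using dense by (metis min_less_iff_conj)
  have s': "q * s < 1" "1 - p * Y < q * s" "0 < s"
    using s assms by (auto simp: L_def field_simps)
  show thesis
    by (rule that [of s "(1 - q * s) / p"]) (use s s' assms in \<open>auto simp: L_def field_simps\<close>)
qed

text \<open>
  As \<open>u\<close> and \<open>p\<close> are positive, so is \<open>q u + e\<close>; hence \<open>2 q u + e\<close> is the positive square root of the
  discriminant.
\<close>

lemma quadratic_root:
  fixes u p q e :: real
  assumes "q > 0" "u > 0" "p > 0" "u * (q * u + e) = p"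
  shows "u = (sqrt (4 * p * q + e\<^sup>2) - e) / (2 * q)"
proof -
  have "q * u + e > 0" using assms by (metis zero_less_mult_pos)
  moreover have "q * u > 0" using assms by simp
  ultimately have "2 * q * u + e > 0" by linarith
  moreover have "4 * p * q + e\<^sup>2 = (2 * q * u + e)\<^sup>2"
    unfolding assms(4) [symmetric] by (simp add: algebra_simps power2_eq_square)
  ultimately have "sqrt (4 * p * q + e\<^sup>2) = 2 * q * u + e" by simp
  then show ?thesis using assms(1) by simp
qed

context game_beatty
begin

text \<open>
  Since \<open>q \<gamma> - p \<delta>\<close> is the integer \<open>c\<close>, the number \<open>q \<gamma> + p (1 - \<delta>) = c + p\<close> is a positive integer. If it
  exceeded 1, the line with \<open>k = c - 1\<close>, the neighbour of the line through \<open>(\<gamma>, \<delta>)\<close>, would cross the drop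
  rectangle.
\<close>

lemma drop_relation:
  assumes "B \<le> 3"
  obtains p q c :: int where "p > 0" "q > 0" "of_int q * \<gamma> - of_int p * \<delta> = of_int c" "c + p = 1"
    "\<And>x y k. of_int q * x - of_int p * y = of_int k \<Longrightarrow> orbit_limit \<gamma> \<delta> x y"
  using gamma_irrational delta_irrational
proof (cases rule: orbit_closure_cases)
  case (falling g h)
  have "min (\<gamma> / h) ((1 - \<delta>) / g) > 0"
    using falling(1,2) gamma_bounds delta_bounds by simp
  then obtain \<tau> where "\<tau> > 0" "\<tau> < \<gamma> / h" "\<tau> < (1 - \<delta>) / g"
    using dense by (metis min_less_iff_conj)
  then have "0 < h * \<tau>" "h * \<tau> < \<gamma>" "0 < g * \<tau>" "g * \<tau> < 1 - \<delta>"
    using falling(1,2) by (auto simp: field_simps)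
  then obtain n where "n > 0" "x n < \<gamma>" "\<delta> < y n"
    using drop_near [OF falling(3) [of \<tau>], of 1 0] by auto
  then have False using drop_impossible [OF assms, of n] by simp
  then show thesis ..
next
  case (rising p q c)
  have sum: "of_int q * \<gamma> + of_int p * (1 - \<delta>) = of_int (c + p)"
    using rising(3) by (simp add: algebra_simps)
  have "of_int q * \<gamma> > 0" "of_int p * (1 - \<delta>) > 0"
    using rising(1,2) gamma_bounds delta_bounds by auto
  then have "c + p > 0" using sum by linarith
  moreover have "\<not> c + p > 1"
  proof
    assume "c + p > 1"
    then have "1 < of_int q * \<gamma> + of_int p * (1 - \<delta>)" using sum by simp
    then obtain s t where st: "0 < s" "s < \<gamma>" "0 < t" "t < 1 - \<delta>" "of_int q * s + of_int p * t = 1"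
      using line_meets_box [of "of_int p" "of_int q" \<gamma> "1 - \<delta>" 1] rising(1,2) gamma_bounds delta_bounds
      by (metis diff_gt_0_iff_gt of_int_0_less_iff zero_less_one)
    have "of_int q * (\<gamma> - s) - of_int p * (\<delta> + t) = of_int (c - 1)"
      using rising(3) st(5) by (simp add: algebra_simps)
    then obtain n where "n > 0" "x n < \<gamma>" "\<delta> < y n"
      using drop_near [OF rising(4), of s t "c - 1" 1 0] st by auto
    then show False using drop_impossible [OF assms, of n] by simp
  qed
  ultimately show thesis using that [of p q c] rising by auto
qed

text \<open>
  The condition on \<open>s + s'\<close> is the condition of \<open>drop_and_jump_impossible\<close> for the limit points
  \<open>(\<gamma> - s, \<delta> + t)\<close> and \<open>(\<gamma> + s', \<delta> - t')\<close>, rewritten with \<open>\<gamma> \<delta> = 1 - 3 \<gamma>\<close>. It is strict, hence survives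
  replacing the limit points by orbit points.
\<close>

lemma close_drop_and_jump_impossible:
  assumes B: "B = 4"
    and st: "orbit_limit \<gamma> \<delta> (\<gamma> - s) (\<delta> + t)" "0 < s" "s < \<gamma>" "0 < t" "t < 1 - \<delta>"
    and st': "orbit_limit \<gamma> \<delta> (\<gamma> + s') (\<delta> - t')" "0 < s'" "s' < 1 - \<gamma>" "0 < t'" "t' < \<delta>"
    and close: "s + s' < 2 * \<gamma> + \<gamma> * t'"
  shows False
proof -
  define \<eta> where "\<eta> = (2 * \<gamma> + \<gamma> * t' - s - s') / 3"
  have \<eta>: "\<eta> > 0" using close by (simp add: \<eta>_def)
  obtain M where M: "M > 0" "\<gamma> < x M" "x M < \<gamma> + s' + \<eta>" "y M < \<delta>" "y M < \<delta> - t' + \<eta>"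
    using jump_near [OF st' \<eta>] by blast
  obtain n where n: "n > M" "\<gamma> - s - \<eta> < x n" "x n < \<gamma>" "\<delta> < y n"
    using drop_near [OF st \<eta>] by blast
  have gd: "\<gamma> * \<delta> = 1 - 3 * \<gamma>" using gamma_delta B by (simp add: algebra_simps)
  have "\<gamma> * y M < \<gamma> * (\<delta> - t' + \<eta>)" using M gamma_bounds by (intro mult_strict_left_mono) auto
  moreover have "\<gamma> * \<eta> < 1 * \<eta>" using \<eta> gamma_bounds by (intro mult_strict_right_mono) auto
  ultimately have "\<gamma> * y M < 1 - 3 * \<gamma> - \<gamma> * t' + \<eta>" using gd by (simp add: algebra_simps)
  then have "x M + \<gamma> * y M - x n < 1 - \<gamma>"
    using M(3) n(2) unfolding \<eta>_def by (simp add: field_simps)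
  then show False using drop_and_jump_impossible [OF B, of M n] M n by simp
qed

text \<open>
  If neither relation holds, the two lines next to the one through \<open>(\<gamma>, \<delta>)\<close> cross the drop and the jump
  rectangle. On each of them the point nearest to the vertical line \<open>x = \<gamma>\<close> is chosen, up to
  \<open>\<eta>\<close>; \<open>L\<close> and \<open>L'\<close> are the limiting horizontal distances, and they satisfy the inequality needed for
  \<open>close_drop_and_jump_impossible\<close> with room to spare.
\<close>

lemma drop_or_jump_relation:
  assumes B: "B = 4"
  obtains p q :: int where "p > 0" "q > 0"
    "of_int q * \<gamma> + of_int p * (1 - \<delta>) = 1 \<or> of_int q * (1 - \<gamma>) + of_int p * \<delta> = 1"
  using gamma_irrational delta_irrational
proof (cases rule: orbit_closure_cases)
  case (falling g h)
  have "Min {\<gamma> / h, (1 - \<gamma>) / h, \<delta> / g, (1 - \<delta>) / g} > 0"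
    using falling(1,2) gamma_bounds delta_bounds by simp
  then obtain \<tau> where "\<tau> > 0" "\<tau> < Min {\<gamma> / h, (1 - \<gamma>) / h, \<delta> / g, (1 - \<delta>) / g}"
    using dense by blast
  then have t: "0 < h * \<tau>" "h * \<tau> < \<gamma>" "h * \<tau> < 1 - \<gamma>" "0 < g * \<tau>" "g * \<tau> < \<delta>" "g * \<tau> < 1 - \<delta>"
    using falling(1,2) by (simp_all add: field_simps)
  have "\<gamma> * (g * \<tau>) > 0" using gamma_bounds t by simp
  then have "h * \<tau> + h * \<tau> < 2 * \<gamma> + \<gamma> * (g * \<tau>)" using t by linarith
  moreover have "orbit_limit \<gamma> \<delta> (\<gamma> + h * \<tau>) (\<delta> - g * \<tau>)" using falling(3) [of "- \<tau>"] by simp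
  ultimately have False
    using close_drop_and_jump_impossible [OF B falling(3) [of \<tau>]] t by blast
  then show thesis ..
next
  case (rising p q c)
  have sum: "of_int q * \<gamma> + of_int p * (1 - \<delta>) = of_int (c + p)"
      "of_int q * (1 - \<gamma>) + of_int p * \<delta> = of_int (q - c)"
    using rising(3) by (simp_all add: algebra_simps)
  have pos: "of_int q * \<gamma> > 0" "of_int p * (1 - \<delta>) > 0" "of_int q * (1 - \<gamma>) > 0" "of_int p * \<delta> > 0"
    using rising(1,2) gamma_bounds delta_bounds by auto
  then have "c + p > 0" "q - c > 0" using sum by linarith+
  show thesis
  proof (cases "c + p = 1 \<or> q - c = 1")
    case True
    then have "of_int q * \<gamma> + of_int p * (1 - \<delta>) = 1 \<or> of_int q * (1 - \<gamma>) + of_int p * \<delta> = 1"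
      unfolding sum by (simp only: of_int_eq_1_iff)
    then show thesis using that rising(1,2) by blast
  next
    case False
    with \<open>c + p > 0\<close> \<open>q - c > 0\<close> have ge2: "c + p \<ge> 2" "q - c \<ge> 2" by auto
    then have gt1: "1 < of_int q * \<gamma> + of_int p * (1 - \<delta>)" "1 < of_int q * (1 - \<gamma>) + of_int p * \<delta>"
      using sum by simp_all
    have pq: "of_int p > (0::real)" "of_int q > (0::real)" using rising(1,2) by simp_all
    have B3: "\<gamma> * (3 + \<delta>) = 1" using gamma_delta B by (simp add: algebra_simps)
    have "\<gamma> * 3 < \<gamma> * (3 + \<delta>)" using gamma_bounds delta_bounds by (intro mult_strict_left_mono) auto
    then have g3: "\<gamma> < 1 / 3" using B3 by simp
    define L L' where "L = max 0 ((1 - of_int p * (1 - \<delta>)) / of_int q)"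
      and "L' = max 0 ((1 - of_int p * \<delta>) / of_int q)"
    \<comment> \<open>\<open>(1 - q L') / p\<close> is the value of \<open>t\<close> at \<open>s = L'\<close> on the line \<open>q s + p t = 1\<close>.\<close>
    have lim: "L + L' < 2 * \<gamma> + \<gamma> * ((1 - of_int q * L') / of_int p)"
    proof (cases "of_int p * \<delta> \<ge> 1")
      case True
      then have "L' = 0" using pq by (simp add: L'_def divide_nonpos_pos)
      moreover have "L < \<gamma>" using gt1(1) pq gamma_bounds by (auto simp: L_def field_simps)
      moreover have "\<gamma> / of_int p > 0" using gamma_bounds pq by simp
      ultimately show ?thesis using gamma_bounds by simp
    next
      case False
      then have L': "L' = (1 - of_int p * \<delta>) / of_int q" using pq by (simp add: L'_def)
      then have "(1 - of_int q * L') / of_int p = \<delta>" using pq by simp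
      moreover have "L + L' < 1 - \<gamma>"
      proof (cases "p \<ge> 2")
        case True
        then have "of_int p \<ge> (2::real)" by linarith
        with False have "1 - of_int p * (1 - \<delta>) \<le> 0" by (simp add: algebra_simps)
        then have "L = 0" using pq by (simp add: L_def divide_nonpos_pos)
        moreover have "L' < 1 - \<gamma>"
          unfolding L' pos_divide_less_eq [OF pq(2)] using gt1(2)
          by (simp only: mult.commute)
        ultimately show ?thesis by simp
      next
        case False
        then have p1: "p = 1" using rising(1) by simp
        then have "q \<ge> 3" using ge2 by simp
        then have "of_int q \<ge> (3::real)" by linarith
        have "L = \<delta> / of_int q" using p1 pq delta_bounds by (simp add: L_def)
        then have "L + L' = 1 / of_int q" using L' p1 by (simp add: add_divide_distrib [symmetric])
        also have "\<dots> \<le> 1 / 3" using \<open>of_int q \<ge> 3\<close> by (simp add: field_simps)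
        finally show ?thesis using g3 by simp
      qed
      ultimately show ?thesis using B3 by (simp add: algebra_simps)
    qed
    \<comment> \<open>Moving both points by \<open>\<eta>\<close> changes the two sides of \<open>lim\<close> by at most \<open>r \<eta>\<close> in total.\<close>
    define r where "r = 2 + \<gamma> * of_int q / of_int p"
    have r: "r > 0" using gamma_bounds pq by (simp add: r_def add_pos_pos)
    define \<eta> where "\<eta> = (2 * \<gamma> + \<gamma> * ((1 - of_int q * L') / of_int p) - L - L') / r"
    have \<eta>: "\<eta> > 0" using lim r by (simp add: \<eta>_def)
    obtain s t where st: "0 < s" "s < \<gamma>" "0 < t" "t < 1 - \<delta>" "of_int q * s + of_int p * t = 1" "s < L + \<eta>"
      using line_meets_box [of "of_int p" "of_int q" \<gamma> "1 - \<delta>" \<eta>] pq gt1 gamma_bounds delta_bounds \<eta>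
      unfolding L_def by auto
    obtain s' t' where st': "0 < s'" "s' < 1 - \<gamma>" "0 < t'" "t' < \<delta>" "of_int q * s' + of_int p * t' = 1"
        "s' < L' + \<eta>"
      using line_meets_box [of "of_int p" "of_int q" "1 - \<gamma>" "\<delta>" \<eta>] pq gt1 gamma_bounds delta_bounds \<eta>
      unfolding L'_def by auto
    have "s + s' < 2 * \<gamma> + \<gamma> * t'"
    proof -
      have "of_int q * s' < of_int q * (L' + \<eta>)" using st' pq by (intro mult_strict_left_mono) auto
      then have "of_int p * t' > 1 - of_int q * (L' + \<eta>)" using st' by linarith
      then have "t' > (1 - of_int q * (L' + \<eta>)) / of_int p" using pq by (simp add: field_simps)
      then have "\<gamma> * t' > \<gamma> * ((1 - of_int q * (L' + \<eta>)) / of_int p)"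
        using gamma_bounds by (intro mult_strict_left_mono) auto
      also have "\<gamma> * ((1 - of_int q * (L' + \<eta>)) / of_int p)
          = \<gamma> * ((1 - of_int q * L') / of_int p) - \<gamma> * of_int q / of_int p * \<eta>"
        by (simp add: diff_divide_distrib add_divide_distrib algebra_simps)
      finally have "\<gamma> * t' > \<gamma> * ((1 - of_int q * L') / of_int p) - \<gamma> * of_int q / of_int p * \<eta>" .
      moreover have "r * \<eta> = 2 * \<gamma> + \<gamma> * ((1 - of_int q * L') / of_int p) - L - L'"
        using r by (simp add: \<eta>_def)
      moreover have "r * \<eta> = 2 * \<eta> + \<gamma> * of_int q / of_int p * \<eta>"
        by (simp add: r_def algebra_simps)
      ultimately show ?thesis using st(6) st'(6) by linarith
    qed
    moreover have "orbit_limit \<gamma> \<delta> (\<gamma> - s) (\<delta> + t)"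
      by (rule rising(4) [of _ _ "c - 1"]) (use rising(3) st(5) in \<open>simp add: algebra_simps\<close>)
    moreover have "orbit_limit \<gamma> \<delta> (\<gamma> + s') (\<delta> - t')"
      by (rule rising(4) [of _ _ "c + 1"]) (use rising(3) st'(5) in \<open>simp add: algebra_simps\<close>)
    ultimately have False using close_drop_and_jump_impossible [OF B] st st' by blast
    then show thesis ..
  qed
qed

text \<open>
  Here \<open>\<gamma> > 1/2\<close>, so \<open>q \<gamma> + p (1 - \<delta>) = 1\<close> leaves only \<open>q = 1\<close>, and \<open>p = 1\<close> gives \<open>\<gamma> = \<delta>\<close>. If \<open>p \<ge> 2\<close>, the
  neighbouring line enters the jump rectangle through its left side, arbitrarily close to \<open>x = \<gamma>\<close>;
  together with a point on the line through \<open>(\<gamma>, \<delta>)\<close>, slightly to the lower left of \<open>(\<gamma>, \<delta>)\<close>, it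
  satisfies the hypotheses of \<open>level_and_jump_impossible\<close>.
\<close>

lemma golden_if_B_2:
  assumes B: "B = 2"
  shows "\<gamma> * (\<gamma> + 1) = 1"
proof -
  obtain p q c :: int where pq: "p > 0" "q > 0" and
    rel: "of_int q * \<gamma> - of_int p * \<delta> = of_int c" "c + p = 1" and
    lim: "\<And>x y k. of_int q * x - of_int p * y = of_int k \<Longrightarrow> orbit_limit \<gamma> \<delta> x y"
    using drop_relation B by (metis order.refl numeral_le_iff semiring_norm(68) semiring_norm(72))
  have gd: "\<gamma> * \<delta> = 1 - \<gamma>" using gamma_delta B by (simp add: algebra_simps)
  have "\<gamma> * \<delta> < \<gamma> * 1" using gamma_bounds delta_bounds by (intro mult_strict_left_mono) auto
  then have g2: "\<gamma> > 1 / 2" using gd by simp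
  have "of_int (c + p) = (1 :: real)" using rel(2) by simp
  then have sum: "of_int q * \<gamma> + of_int p * (1 - \<delta>) = 1" using rel(1) by (simp add: algebra_simps)
  have "of_int p * (1 - \<delta>) > 0" using pq delta_bounds by simp
  then have "of_int q * \<gamma> < 1" using sum by linarith
  moreover have "of_int q * (1 / 2) < of_int q * \<gamma>" using g2 pq by (intro mult_strict_left_mono) auto
  ultimately have "of_int q < (2 :: real)" by linarith
  then have q1: "q = 1" using pq by simp
  have "\<not> p \<ge> 2"
  proof
    assume "p \<ge> 2"
    then have p2: "of_int p \<ge> (2::real)" by linarith
    have psum: "of_int p * (1 - \<delta>) = 1 - \<gamma>" using sum q1 by simp
    then have pd: "of_int p * \<delta> > 1" using p2 gamma_bounds by (simp add: algebra_simps)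
    \<comment> \<open>Small enough for \<open>x n > \<gamma> / 2\<close> with \<open>x M < 3 \<gamma> / 2\<close>, so that \<open>x M - x n < \<gamma>\<close>; and \<open>\<gamma> y M < \<gamma> \<delta> = 1 - \<gamma>\<close>.\<close>
    define \<tau> where "\<tau> = min (\<gamma> / (8 * of_int p)) (\<delta> / 2)"
    have \<tau>: "\<tau> > 0" using gamma_bounds delta_bounds p2 by (simp add: \<tau>_def)
    have "\<tau> \<le> \<gamma> / (8 * of_int p)" by (simp add: \<tau>_def)
    then have p\<tau>: "of_int p * \<tau> \<le> \<gamma> / 8" using p2 by (simp add: field_simps)
    have \<tau>\<delta>: "\<tau> < \<delta>" using delta_bounds by (simp add: \<tau>_def min_def)
    have p\<tau>0: "of_int p * \<tau> > 0" using \<tau> p2 by simp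
    have "1 < of_int q * (1 - \<gamma>) + of_int p * \<delta>" using pd q1 gamma_bounds by simp
    then obtain s t where st: "0 < s" "s < 1 - \<gamma>" "0 < t" "t < \<delta>" "of_int q * s + of_int p * t = 1"
        "s < max 0 ((1 - of_int p * \<delta>) / of_int q) + \<gamma> / 4"
      using line_meets_box [of "of_int p" "of_int q" "1 - \<gamma>" \<delta> "\<gamma> / 4"] pq gamma_bounds delta_bounds by auto
    have s: "s < \<gamma> / 4" using st(6) pd q1 by simp
    have "orbit_limit \<gamma> \<delta> (\<gamma> + s) (\<delta> - t)"
      by (rule lim [of _ _ "c + 1"]) (use rel(1) st(5) in \<open>simp add: algebra_simps\<close>)
    then obtain M where M: "M > 0" "\<gamma> < x M" "x M < \<gamma> + s + \<gamma> / 4" "y M < \<delta>"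
      using jump_near [of s t "\<gamma> / 4" 0] st gamma_bounds by auto
    have "orbit_limit \<gamma> \<delta> (\<gamma> - of_int p * \<tau>) (\<delta> - \<tau>)"
      by (rule lim [of _ _ c]) (use rel(1) q1 in \<open>simp add: algebra_simps\<close>)
    then obtain n where n: "n > M" "\<gamma> / 2 < frac (real n * \<gamma>)" "frac (real n * \<gamma>) < \<gamma>"
        "0 < frac (real n * \<delta>)" "frac (real n * \<delta>) < \<delta>"
      by (rule orbit_limit_box [of _ _ _ _ "\<gamma> / 2" \<gamma> 0 \<delta> M])
        (use p\<tau> p\<tau>0 \<tau> \<tau>\<delta> gamma_bounds delta_bounds in auto)
    have "\<gamma> * y M < \<gamma> * \<delta>" using M gamma_bounds by (intro mult_strict_left_mono) auto
    then have "x M + \<gamma> * y M - x n < 1"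
      using M(3) n(2) s gd by (simp add: x_def)
    then show False
      using level_and_jump_impossible [OF B, of M n] M n by (simp add: x_def y_def)
  qed
  then have "p = 1" using pq by simp
  then have "\<gamma> = \<delta>" using sum q1 by simp
  then show ?thesis using gd by (simp add: algebra_simps)
qed

end

section \<open>The four alternatives\<close>

theorem theorem4:
  fixes \<alpha> \<beta> :: real
  assumes "0 < \<alpha>" and "\<alpha> < \<beta>"
    and "\<alpha> \<notin> \<rat>" and "\<beta> \<notin> \<rat>"
    and "1 / \<alpha> + 1 / \<beta> = 1"
    and "\<exists>f :: nat \<Rightarrow> int.
      {p. P_position f p} = {(nat \<lfloor>real n * \<alpha>\<rfloor>, nat \<lfloor>real n * \<beta>\<rfloor>) | n :: nat. True}"
  shows
    "((\<exists>t::int. t > 0 \<and> \<alpha> = (2 - of_int t + sqrt ((of_int t)\<^sup>2 + 4)) / 2)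
      \<or> ((\<lfloor>\<beta>\<rfloor> = 3 \<or> \<lfloor>\<beta>\<rfloor> = 4) \<and>
          (\<exists>p q :: int. p > 0 \<and> q > 0 \<and>
            \<alpha> = (sqrt (4 * of_int p * of_int q + (of_int \<lfloor>\<beta>\<rfloor> * of_int p - 1)\<^sup>2)
                  + 2 * of_int q - (of_int \<lfloor>\<beta>\<rfloor> * of_int p - 1)) / (2 * of_int q)))
      \<or> (\<lfloor>\<beta>\<rfloor> = 4 \<and>
          (\<exists>p q :: int. p > 0 \<and> q > 0 \<and>
            \<alpha> = (sqrt (4 * of_int p * of_int q + (of_int q - 3 * of_int p - 1)\<^sup>2)
                  + 3 * of_int q - 3 * of_int p - 1) / (2 * of_int q)))
      \<or> \<lfloor>\<beta>\<rfloor> \<ge> 5)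
     \<and> (\<lfloor>\<beta>\<rfloor> \<ge> 5 \<longleftrightarrow> \<alpha> < 5 / 4)"
proof -
  obtain f where f: "{p. P_position f p} = {(nat \<lfloor>real n * \<alpha>\<rfloor>, nat \<lfloor>real n * \<beta>\<rfloor>) | n :: nat. True}"
    using assms(6) by blast
  interpret game_beatty \<alpha> \<beta> f
    by unfold_locales (fact assms f)+
  have \<alpha>: "\<alpha> = r" if "\<gamma> + 1 = r" for r using that by (simp add: \<gamma>_def)
  have drop_formula: "\<alpha> = (sqrt (4 * of_int p * of_int q + (of_int B * of_int p - 1)\<^sup>2)
      + 2 * of_int q - (of_int B * of_int p - 1)) / (2 * of_int q)"
    if "p > 0" "q > 0" "of_int q * \<gamma> + of_int p * (1 - \<delta>) = 1" for p q :: int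
  proof -
    have "of_int q * \<gamma> + (of_int B * of_int p - 1) = of_int p * (of_int B - 1 + \<delta>)"
      using that(3) by (simp add: algebra_simps)
    then have "\<gamma> * (of_int q * \<gamma> + (of_int B * of_int p - 1)) = of_int p * (\<gamma> * (of_int B - 1 + \<delta>))"
      by simp
    then have "\<gamma> * (of_int q * \<gamma> + (of_int B * of_int p - 1)) = of_int p"
      unfolding gamma_delta by simp
    then have "\<gamma> = (sqrt (4 * of_int p * of_int q + (of_int B * of_int p - 1)\<^sup>2)
        - (of_int B * of_int p - 1)) / (2 * of_int q)"
      using that gamma_bounds by (intro quadratic_root) auto
    then show ?thesis by (intro \<alpha>) (use that(2) in \<open>simp add: field_simps\<close>)
  qed
  have jump_formula: "\<alpha> = (sqrt (4 * of_int p * of_int q + (of_int q - 3 * of_int p - 1)\<^sup>2)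
      + 3 * of_int q - 3 * of_int p - 1) / (2 * of_int q)"
    if "p > 0" "q > 0" "of_int q * (1 - \<gamma>) + of_int p * \<delta> = 1" "B = 4" for p q :: int
  proof -
    define e :: real where "e = - (of_int q - 3 * of_int p - 1)"
    have "of_int q * \<gamma> + e = of_int p * (of_int B - 1 + \<delta>)"
      using that(3,4) by (simp add: e_def algebra_simps)
    then have "\<gamma> * (of_int q * \<gamma> + e) = of_int p * (\<gamma> * (of_int B - 1 + \<delta>))"
      by simp
    then have "\<gamma> * (of_int q * \<gamma> + e) = of_int p"
      unfolding gamma_delta by simp
    then have "\<gamma> = (sqrt (4 * of_int p * of_int q + e\<^sup>2) - e) / (2 * of_int q)"
      using that gamma_bounds by (intro quadratic_root) auto
    moreover have "e\<^sup>2 = (of_int q - 3 * of_int p - 1)\<^sup>2" unfolding e_def by (rule power2_minus)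
    ultimately have "\<gamma> = (sqrt (4 * of_int p * of_int q + (of_int q - 3 * of_int p - 1)\<^sup>2)
        + (of_int q - 3 * of_int p - 1)) / (2 * of_int q)"
      by (simp add: e_def)
    then show ?thesis by (intro \<alpha>) (use that(2) in \<open>simp add: field_simps\<close>)
  qed
  have "\<lfloor>\<beta>\<rfloor> \<ge> 5 \<longleftrightarrow> \<alpha> < 5 / 4"
  proof -
    have "\<alpha> \<noteq> 5 / 4" using alpha_irrational by (metis Rats_divide Rats_number_of)
    have "\<lfloor>\<beta>\<rfloor> \<ge> 5 \<longleftrightarrow> 4 \<le> \<beta> - 1" by (simp add: le_floor_iff)
    also have "\<beta> - 1 = 1 / \<gamma>"
      using product_form gamma_bounds by (simp add: \<gamma>_def field_simps)
    also have "4 \<le> 1 / \<gamma> \<longleftrightarrow> \<gamma> \<le> 1 / 4" using gamma_bounds by (simp add: field_simps)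
    also have "\<dots> \<longleftrightarrow> \<alpha> < 5 / 4" using \<open>\<alpha> \<noteq> 5 / 4\<close> by (auto simp: \<gamma>_def)
    finally show ?thesis .
  qed
  moreover consider "B = 2" | "B = 3" | "B = 4" | "B \<ge> 5" using B_ge_2 by linarith
  then have "(\<exists>t::int. t > 0 \<and> \<alpha> = (2 - of_int t + sqrt ((of_int t)\<^sup>2 + 4)) / 2)
      \<or> ((B = 3 \<or> B = 4) \<and>
          (\<exists>p q :: int. p > 0 \<and> q > 0 \<and>
            \<alpha> = (sqrt (4 * of_int p * of_int q + (of_int B * of_int p - 1)\<^sup>2)
                  + 2 * of_int q - (of_int B * of_int p - 1)) / (2 * of_int q)))
      \<or> (B = 4 \<and>
          (\<exists>p q :: int. p > 0 \<and> q > 0 \<and>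
            \<alpha> = (sqrt (4 * of_int p * of_int q + (of_int q - 3 * of_int p - 1)\<^sup>2)
                  + 3 * of_int q - 3 * of_int p - 1) / (2 * of_int q)))
      \<or> B \<ge> 5"
  proof cases
    case 1
    then have "\<gamma> * (1 * \<gamma> + 1) = 1" using golden_if_B_2 by simp
    then have "\<gamma> = (sqrt (4 * 1 * 1 + 1\<^sup>2) - 1) / (2 * 1)"
      using gamma_bounds by (intro quadratic_root) auto
    then have "\<alpha> = (2 - of_int 1 + sqrt ((of_int 1)\<^sup>2 + 4)) / 2" by (intro \<alpha>) simp
    then show ?thesis by (metis zero_less_one)
  next
    case 2
    then obtain p q c :: int where pq: "p > 0" "q > 0" and
      rel: "of_int q * \<gamma> - of_int p * \<delta> = of_int c" "c + p = 1"
      using drop_relation by (metis order.refl)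
    have "of_int (c + p) = (1 :: real)" using rel(2) by simp
    then have "of_int q * \<gamma> + of_int p * (1 - \<delta>) = 1" using rel(1) by (simp add: algebra_simps)
    then show ?thesis using drop_formula [OF pq] pq 2 by blast
  next
    case 3
    then obtain p q :: int where pq: "p > 0" "q > 0"
      "of_int q * \<gamma> + of_int p * (1 - \<delta>) = 1 \<or> of_int q * (1 - \<gamma>) + of_int p * \<delta> = 1"
      using drop_or_jump_relation by metis
    then show ?thesis using drop_formula [OF pq(1,2)] jump_formula [OF pq(1,2)] 3 by blast
  next
    case 4
    then show ?thesis by blast
  qed
  ultimately show ?thesis unfolding B_def by blast
qed

end
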